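(* Let $\rho$ be a sound partial solver. Then: (1) if $\rho$ satisfies Soundness, Idempotency, and Locality, then $\mathsf{lift}(\rho)$ satisfies Soundness; (2) the computational time complexity of $\mathsf{lift}(\rho)$ on a game with node set $V$ and edge set $E$ is in $O((|E|-|V|)^2\cdot|\rho|)$, where $|\rho|$ is the computational time complexity of $\rho$; in particular, $\mathsf{lift}(\rho)$ runs in polynomial time if $\rho$ does.
   Context: A parity game is a tuple $G=(V,V_0,V_1,E,c)$ where $V$ is a finite set of nodes partitioned into $V_0,V_1$, $E\subseteq V\times V$ with every node having a successor, and $c\colon V\to\mathbb{N}$. Player $0$ wins a play iff the minimal color occurring infinitely often is even, else player $1$ wins; winning regions are defined as usual. A partial solver $\rho$ maps each parity game $G$ to a sub-game $\rho(G)$ (a subset of nodes on which the restricted game has every node with a successor) together with sets $\mathrm{Win}_\rho(G,0),\mathrm{Win}_\rho(G,1)$ of nodes of $G$ it classifies as won by player $0$, respectively $1$ (these together form the nodes of $G$ not in $\rho(G)$). For an edge $e=(v,w)\in E$: $G_e$ is $G$ with edge set $\{(v',w')\in E\mid v'\neq v\text{ or }w'=w\}$, and $G\setminus e$ is $G$ with edge set $E\setminus\{e\}$. Soundness: for all $G,p$, every node of $\mathrm{Win}_\rho(G,p)$ is won by player $p$ in $G$. Idempotency: $\rho(\rho(G))=\rho(G)$ for all $G$. Locality: for all $G$, $p$, and edges $e=(v,w)$ with $v\in V_p$, if $\mathrm{Win}_\rho(G,1-p)=\emptyset$ and $\mathrm{Win}_\rho(G_e,1-p)\neq\emptyset$ then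 $v\in\mathrm{Win}_\rho(G_e,1-p)$. The transformation $\mathsf{lift}(\rho)$ on input $G$: (l1) set $G:=\rho(G)$; (l2) for each node $v$ of $G$ with out-degree $>1$: let $p$ be the owner of $v$ and $W:=v.E$; for each $w\in W$: if $\mathrm{Win}_\rho(G_{(v,w)},1-p)\neq\emptyset$, return $\mathsf{lift}(\rho)(G\setminus(v,w))$; (l9) if the loops finish, return $G$. The nodes classified by $\mathsf{lift}(\rho)$ as won by player $p$, $\mathrm{Win}_{\mathsf{lift}(\rho)}(G,p)$, are the union of the sets $\mathrm{Win}_\rho(H,p)$ over all games $H$ to which $\rho$ is applied at step (l1) in the (recursive) run; the output sub-game is the finally returned game. Soundness of $\mathsf{lift}(\rho)$ means each node of $\mathrm{Win}_{\mathsf{lift}(\rho)}(G,p)$ is won by player $p$ in the original input game $G$.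
   Formalization: In (1), which is false as stated, each set Win_ρ(G,p) is also assumed closed under p-attractors in G; in (2), |E|-|V| is replaced by max(1,|E|-|V|), and for the O-bound ρ is assumed to take at least linear time, with bookkeeping linear in the graph per call of ρ. *)

theory Defs
  imports
    "HOL-Library.Extended_Nat"
    "HOL-Library.Log_Nat"
    "HOL-Computational_Algebra.Polynomial"
begin

subsection \<open>Parity games\<close>

datatype player = P0 | P1

fun opp :: "player \<Rightarrow> player" where
  "opp P0 = P1"
| "opp P1 = P0"

text \<open>
  The colouring is a total function; its values outside the node set are irrelevant. The node set
  may be empty, since a partial solver may classify all nodes of a game.
\<close>

record 'v game =
  own :: "player \<Rightarrow> 'v set"
  edges :: "('v \<times> 'v) set"
  colour :: "'v \<Rightarrow> nat"

definition nodes :: "'v game \<Rightarrow> 'v set" where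
  "nodes G = own G P0 \<union> own G P1"

definition succs :: "'v game \<Rightarrow> 'v \<Rightarrow> 'v set" where
  "succs G v = edges G `` {v}"

definition parity_game :: "'v game \<Rightarrow> bool" where
  "parity_game G \<longleftrightarrow>
     finite (nodes G) \<and> own G P0 \<inter> own G P1 = {} \<and>
     edges G \<subseteq> nodes G \<times> nodes G \<and> (\<forall>v \<in> nodes G. succs G v \<noteq> {})"

definition owner :: "'v game \<Rightarrow> 'v \<Rightarrow> player" where
  "owner G v = (if v \<in> own G P0 then P0 else P1)"

definition restrict_game :: "'v game \<Rightarrow> 'v set \<Rightarrow> 'v game" where
  "restrict_game G U =
     \<lparr>own = (\<lambda>p. own G p \<inter> U), edges = edges G \<inter> U \<times> U, colour = colour G\<rparr>"

text \<open>The games $G_e$ and $G \setminus e$.\<close>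

definition fix_edge :: "'v game \<Rightarrow> 'v \<times> 'v \<Rightarrow> 'v game" where
  "fix_edge G e = G\<lparr>edges := {(v', w') \<in> edges G. v' \<noteq> fst e \<or> w' = snd e}\<rparr>"

definition del_edge :: "'v game \<Rightarrow> 'v \<times> 'v \<Rightarrow> 'v game" where
  "del_edge G e = G\<lparr>edges := edges G - {e}\<rparr>"

definition is_play :: "'v game \<Rightarrow> 'v \<Rightarrow> (nat \<Rightarrow> 'v) \<Rightarrow> bool" where
  "is_play G v \<pi> \<longleftrightarrow> \<pi> 0 = v \<and> (\<forall>i. (\<pi> i, \<pi> (Suc i)) \<in> edges G)"

text \<open>As the node set is finite, some colour occurs infinitely often in every play.\<close>

definition play_won_by :: "'v game \<Rightarrow> player \<Rightarrow> (nat \<Rightarrow> 'v) \<Rightarrow> bool" where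
  "play_won_by G p \<pi> \<longleftrightarrow>
     (even (LEAST k. infinite {i. colour G (\<pi> i) = k}) \<longleftrightarrow> p = P0)"

text \<open>Strategies may depend on the whole (non-empty) history, whose last element is the current node.\<close>

definition is_strategy :: "'v game \<Rightarrow> player \<Rightarrow> ('v list \<Rightarrow> 'v) \<Rightarrow> bool" where
  "is_strategy G p \<sigma> \<longleftrightarrow>
     (\<forall>h. h \<noteq> [] \<and> last h \<in> own G p \<longrightarrow> (last h, \<sigma> h) \<in> edges G)"

definition conforms :: "'v game \<Rightarrow> player \<Rightarrow> ('v list \<Rightarrow> 'v) \<Rightarrow> (nat \<Rightarrow> 'v) \<Rightarrow> bool" where
  "conforms G p \<sigma> \<pi> \<longleftrightarrow>
     (\<forall>i. \<pi> i \<in> own G p \<longrightarrow> \<pi> (Suc i) = \<sigma> (map \<pi> [0..<Suc i]))"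

definition win_region :: "'v game \<Rightarrow> player \<Rightarrow> 'v set" where
  "win_region G p =
     {v \<in> nodes G. \<exists>\<sigma>. is_strategy G p \<sigma> \<and>
        (\<forall>\<pi>. is_play G v \<pi> \<and> conforms G p \<sigma> \<pi> \<longrightarrow> play_won_by G p \<pi>)}"


subsection \<open>Partial solvers\<close>

record 'v solver =
  residual :: "'v game \<Rightarrow> 'v game"
  win :: "'v game \<Rightarrow> player \<Rightarrow> 'v set"

definition partial_solver :: "'v solver \<Rightarrow> bool" where
  "partial_solver \<rho> \<longleftrightarrow>
     (\<forall>G. parity_game G \<longrightarrow>
        (\<exists>U \<subseteq> nodes G. residual \<rho> G = restrict_game G U \<and> parity_game (residual \<rho> G) \<and>
           win \<rho> G P0 \<union> win \<rho> G P1 = nodes G - U))"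

definition soundness :: "'v solver \<Rightarrow> bool" where
  "soundness \<rho> \<longleftrightarrow> (\<forall>G p. parity_game G \<longrightarrow> win \<rho> G p \<subseteq> win_region G p)"

definition idempotency :: "'v solver \<Rightarrow> bool" where
  "idempotency \<rho> \<longleftrightarrow> (\<forall>G. parity_game G \<longrightarrow> residual \<rho> (residual \<rho> G) = residual \<rho> G)"

definition locality :: "'v solver \<Rightarrow> bool" where
  "locality \<rho> \<longleftrightarrow>
     (\<forall>G p v w. parity_game G \<and> (v, w) \<in> edges G \<and> v \<in> own G p \<and>
        win \<rho> G (opp p) = {} \<and> win \<rho> (fix_edge G (v, w)) (opp p) \<noteq> {} \<longrightarrow>
        v \<in> win \<rho> (fix_edge G (v, w)) (opp p))"

text \<open>
  The set of nodes classified as won by a player is its own attractor for that player. This is the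
  usual convention for removing solved nodes from a game; it is what makes the status of a node in
  the residual game meaningful for the input game. Soundness of the lifted solver fails without it:
  let \<open>u\<close>, \<open>w\<close>, \<open>x\<close> be owned by player 0 with colours 1, 1, 0 and edges
  \<open>(u,u)\<close>, \<open>(u,w)\<close>, \<open>(u,x)\<close>, \<open>(w,u)\<close>, \<open>(x,x)\<close>, and let a solver remove only \<open>x\<close>,
  although \<open>u\<close> is attracted to \<open>x\<close>; if it leaves the residual game alone but solves the two games
  obtained from that one by deleting one of the edges at \<open>u\<close> (and solves nothing else), it is
  sound, idempotent and local, but the lifted solver classifies \<open>u\<close> as won by player 1.
\<close>

definition attractor_closed :: "'v game \<Rightarrow> player \<Rightarrow> 'v set \<Rightarrow> bool" where
  "attractor_closed G p X \<longleftrightarrow>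
     (\<forall>v \<in> own G p. succs G v \<inter> X \<noteq> {} \<longrightarrow> v \<in> X) \<and>
     (\<forall>v \<in> own G (opp p). succs G v \<subseteq> X \<longrightarrow> v \<in> X)"

definition removes_attractors :: "'v solver \<Rightarrow> bool" where
  "removes_attractors \<rho> \<longleftrightarrow> (\<forall>G p. parity_game G \<longrightarrow> attractor_closed G p (win \<rho> G p))"


subsection \<open>The transformation\<close>

text \<open>
  The two loops visit nodes and successors in an unspecified order. A schedule resolves this choice.
  No generality is lost by letting it depend on the current game only, because the games encountered
  in a run are pairwise distinct.
\<close>

record 'v schedule =
  node_seq :: "'v game \<Rightarrow> 'v list"
  succ_seq :: "'v game \<Rightarrow> 'v \<Rightarrow> 'v list"

definition valid_schedule :: "'v schedule \<Rightarrow> bool" where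
  "valid_schedule S \<longleftrightarrow>
     (\<forall>G. parity_game G \<longrightarrow>
        distinct (node_seq S G) \<and> set (node_seq S G) = nodes G \<and>
        (\<forall>v \<in> nodes G. distinct (succ_seq S G v) \<and> set (succ_seq S G v) = succs G v))"

definition loop_edges :: "'v schedule \<Rightarrow> 'v game \<Rightarrow> ('v \<times> 'v) list" where
  "loop_edges S G =
     concat (map (\<lambda>v. map (Pair v) (succ_seq S G v))
       (filter (\<lambda>v. card (succs G v) > 1) (node_seq S G)))"

definition test_succeeds :: "'v solver \<Rightarrow> 'v game \<Rightarrow> 'v \<times> 'v \<Rightarrow> bool" where
  "test_succeeds \<rho> G e \<longleftrightarrow> win \<rho> (fix_edge G e) (opp (owner G (fst e))) \<noteq> {}"

text \<open>
  A run records, in order, the games to which the solver is applied at the start of each (recursive)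
  invocation, the games to which it is applied inside the loops, and the game returned.
  The value \<open>None\<close> of \<open>lift_run\<close> stands for non-termination.
\<close>

record 'v run =
  main_calls :: "'v game list"
  loop_calls :: "'v game list"
  final_game :: "'v game"

partial_function (option) lift_run :: "'v schedule \<Rightarrow> 'v solver \<Rightarrow> 'v game \<Rightarrow> 'v run option" where
  "lift_run S \<rho> G =
     (let H = residual \<rho> G;
          failing = takeWhile (\<lambda>e. \<not> test_succeeds \<rho> H e) (loop_edges S H)
      in case dropWhile (\<lambda>e. \<not> test_succeeds \<rho> H e) (loop_edges S H) of
           [] \<Rightarrow> Some \<lparr>main_calls = [G], loop_calls = map (fix_edge H) failing, final_game = H\<rparr>
         | e # _ \<Rightarrow>
             Option.bind (lift_run S \<rho> (del_edge H e))
               (\<lambda>r. Some \<lparr>main_calls = G # main_calls r,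
                          loop_calls = map (fix_edge H) (failing @ [e]) @ loop_calls r,
                          final_game = final_game r\<rparr>))"

definition lift :: "'v schedule \<Rightarrow> 'v solver \<Rightarrow> 'v solver" where
  "lift S \<rho> =
     \<lparr>residual = (\<lambda>G. final_game (the (lift_run S \<rho> G))),
      win = (\<lambda>G p. \<Union>H \<in> set (main_calls (the (lift_run S \<rho> G))). win \<rho> H p)\<rparr>"


subsection \<open>Running time\<close>

text \<open>
  \<open>T G\<close> is the time a solver needs on \<open>G\<close>, and \<open>b H\<close> is the time spent outside the solver
  (constructing games, running the loops, testing for emptiness) for each application to a game \<open>H\<close>.
\<close>

definition lift_time ::
  "'v schedule \<Rightarrow> 'v solver \<Rightarrow> ('v game \<Rightarrow> nat) \<Rightarrow> ('v game \<Rightarrow> nat) \<Rightarrow> 'v game \<Rightarrow> nat" where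
  "lift_time S \<rho> T b G =
     (let r = the (lift_run S \<rho> G) in \<Sum>H \<leftarrow> main_calls r @ loop_calls r. T H + b H)"

definition graph_size :: "'v game \<Rightarrow> nat" where
  "graph_size G = 1 + card (nodes G) + card (edges G)"

definition at_most_linear :: "('v game \<Rightarrow> nat) \<Rightarrow> bool" where
  "at_most_linear b \<longleftrightarrow> (\<exists>K. \<forall>G. parity_game G \<longrightarrow> b G \<le> K * graph_size G)"

text \<open>An algorithm that reads its whole input takes at least linear time.\<close>

definition at_least_linear :: "('v game \<Rightarrow> nat) \<Rightarrow> bool" where
  "at_least_linear T \<longleftrightarrow> (\<exists>K. \<forall>G. parity_game G \<longrightarrow> graph_size G \<le> K * T G)"

definition max_colour :: "'v game \<Rightarrow> nat" where
  "max_colour G = Max (insert 0 (colour G ` nodes G))"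

text \<open>Worst-case running time over all games with at most the given size parameters.\<close>

definition time_complexity :: "('v game \<Rightarrow> nat) \<Rightarrow> nat \<Rightarrow> nat \<Rightarrow> nat \<Rightarrow> enat" where
  "time_complexity T n m d =
     (SUP G \<in> {G. parity_game G \<and> card (nodes G) \<le> n \<and> card (edges G) \<le> m \<and> max_colour G \<le> d}.
        enat (T G))"

text \<open>Colours are encoded in binary.\<close>

definition input_length :: "'v game \<Rightarrow> nat" where
  "input_length G = card (nodes G) + card (edges G) + (\<Sum>v \<in> nodes G. floorlog 2 (colour G v))"

definition polynomial_time :: "('v game \<Rightarrow> nat) \<Rightarrow> bool" where
  "polynomial_time T \<longleftrightarrow>
     (\<exists>q :: nat poly. \<forall>G. parity_game G \<longrightarrow> T G \<le> poly q (input_length G))"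

end

(* Running time: |E| - |V| is the sum over all nodes of the out-degree minus 1. It does not grow when
   passing to a sub-game and drops by 1 with each deleted edge, which bounds both the recursion depth
   and, up to a factor 2, the number of edges tested per invocation.

   Soundness: winning regions of the games in a run are contained in those of the input game.
   (a) From the residual game to G: the opponent can leave the residual game only into nodes already
   classified as won by the player, because the classified sets are attractors.
   (b) From H \ e to H, where e = (v,w) and v is owned by p: for p this is clear. By locality and
   soundness the opponent of p wins H_e from v, and wins in H by playing the strategies for H \ e
   and H_e in parallel, switching according to the choice of p at v. Each of the two interleaved plays
   is won if it is infinite, and the minimal colour seen infinitely often in the whole play is the
   minimal such colour of one of them. No positional determinacy is needed. *)

theory Submission
  imports Defs
begin

section \<open>Ownership and elementary operations on games\<close>

lemma opp_opp [simp]: "opp (opp p) = p"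
  by (cases p) auto

lemma nodes_own: "nodes G = own G p \<union> own G (opp p)"
  by (cases p) (auto simp: nodes_def)

lemma own_disjoint: "parity_game G \<Longrightarrow> own G p \<inter> own G (opp p) = {}"
  by (cases p) (auto simp: parity_game_def)

lemma fix_edge_simps [simp]:
  "own (fix_edge G e) = own G" "colour (fix_edge G e) = colour G" "nodes (fix_edge G e) = nodes G"
  "edges (fix_edge G e) = {(v', w') \<in> edges G. v' \<noteq> fst e \<or> w' = snd e}"
  by (auto simp: fix_edge_def nodes_def)

lemma del_edge_simps [simp]:
  "own (del_edge G e) = own G" "colour (del_edge G e) = colour G" "nodes (del_edge G e) = nodes G"
  "edges (del_edge G e) = edges G - {e}"
  by (auto simp: del_edge_def nodes_def)

lemma restrict_game_simps [simp]:
  "own (restrict_game G U) p = own G p \<inter> U" "colour (restrict_game G U) = colour G"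
  "nodes (restrict_game G U) = nodes G \<inter> U" "edges (restrict_game G U) = edges G \<inter> U \<times> U"
  by (auto simp: restrict_game_def nodes_def)

lemma owner_own: "v \<in> nodes G \<Longrightarrow> v \<in> own G (owner G v)"
  by (auto simp: owner_def nodes_def)

lemma parity_game_finite_edges: "parity_game G \<Longrightarrow> finite (edges G)"
  unfolding parity_game_def by (meson finite_SigmaI finite_subset)

lemma parity_game_finite_succs: "parity_game G \<Longrightarrow> finite (succs G v)"
  by (simp add: parity_game_finite_edges succs_def finite_Image)

lemma parity_game_fix_edge: "parity_game G \<Longrightarrow> e \<in> edges G \<Longrightarrow> parity_game (fix_edge G e)"
  by (cases e) (fastforce simp: parity_game_def succs_def)

text \<open>Only \<open>v\<close> could lose its last successor, which an out-degree above 1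
  prevents.\<close>

lemma parity_game_del_edge:
  assumes "parity_game G" "card (succs G v) > 1"
  shows "parity_game (del_edge G (v, w))"
proof -
  have "succs (del_edge G (v, w)) u \<noteq> {}" if "u \<in> nodes G" for u
  proof (cases "u = v")
    case True
    have "\<not> succs G v \<subseteq> {w}"
      using assms(2) card_mono[of "{w}" "succs G v"] by auto
    then show ?thesis using True by (auto simp: succs_def)
  next
    case False
    then show ?thesis using that assms(1) by (auto simp: succs_def parity_game_def)
  qed
  then show ?thesis using assms(1) by (auto simp: parity_game_def)
qed


section \<open>Plays and strategies\<close>

text \<open>A shift drops only finitely many indices; the proof reuses the shift invariance of
  \<open>sequentially\<close>, which is the cofinite filter on the naturals.\<close>

lemma infinite_seg: "infinite {i. P (i + k)} \<longleftrightarrow> infinite {i::nat. P i}"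
proof -
  have "finite {i. P (i + k)} \<longleftrightarrow> finite {i. P i}"
    using eventually_sequentially_seg[of "\<lambda>i. \<not> P i" k]
    unfolding cofinite_eq_sequentially[symmetric] eventually_cofinite by simp
  then show ?thesis by simp
qed

text \<open>Prefix independence of the parity condition: a play may be judged by any of its
  tails.\<close>

lemma play_won_by_shift:
  "play_won_by G p (\<lambda>i. \<pi> (i + k)) \<longleftrightarrow> play_won_by G p \<pi>"
  unfolding play_won_by_def using infinite_seg[of "\<lambda>i. colour G (\<pi> i) = _" k] by simp

lemma is_play_nodes:
  assumes "parity_game G" "is_play G v \<pi>" shows "\<pi> i \<in> nodes G"
  using assms unfolding is_play_def parity_game_def by blast

lemma is_strategy_prefix:
  assumes "is_strategy G p \<sigma>" "\<pi> i \<in> own G p"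
  shows "(\<pi> i, \<sigma> (map \<pi> [0..<Suc i])) \<in> edges G"
  using assms(1)[unfolded is_strategy_def, rule_format, of "map \<pi> [0..<Suc i]"] assms(2) by simp

text \<open>The guarded form holds at every \<open>v\<close>, so one strategy per starting node can
  be chosen at once; outside the winning region any legal strategy serves as default.\<close>

lemma ex_strategy:
  assumes "parity_game G"
  shows "\<exists>\<sigma>. is_strategy G p \<sigma> \<and>
    (v \<in> win_region G p \<longrightarrow>
      (\<forall>\<pi>. is_play G v \<pi> \<and> conforms G p \<sigma> \<pi> \<longrightarrow> play_won_by G p \<pi>))"
proof (cases "v \<in> win_region G p")
  case True
  then show ?thesis by (auto simp: win_region_def)
next
  case False
  have "(u, SOME w. w \<in> succs G u) \<in> edges G" if "u \<in> own G p" for u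
  proof -
    have "succs G u \<noteq> {}" using assms that nodes_own[of G p] by (auto simp: parity_game_def)
    then show ?thesis using some_in_eq[of "succs G u"] by (simp add: succs_def)
  qed
  then have "is_strategy G p (\<lambda>h. SOME w. w \<in> succs G (last h))" by (auto simp: is_strategy_def)
  then show ?thesis using False by blast
qed

text \<open>The winning strategy follows the one for the restricted game inside \<open>U\<close> and restarts with
  a winning strategy for the whole game at the first node outside \<open>U\<close>.\<close>

lemma win_region_restrict_game:
  assumes G: "parity_game G"
    and exit: "\<And>x y. (x, y) \<in> edges G \<Longrightarrow> x \<in> own G (opp p) \<inter> U \<Longrightarrow> y \<in> U \<union> win_region G p"
  shows "win_region (restrict_game G U) p \<subseteq> win_region G p"
proof
  fix u assume u: "u \<in> win_region (restrict_game G U) p"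
  let ?R = "restrict_game G U"
  obtain \<sigma> where \<sigma>: "is_strategy ?R p \<sigma>"
    and \<sigma>_win: "\<And>\<pi>. is_play ?R u \<pi> \<Longrightarrow> conforms ?R p \<sigma> \<pi> \<Longrightarrow> play_won_by ?R p \<pi>"
    using u by (auto simp: win_region_def)
  have uU: "u \<in> U" "u \<in> nodes G" using u by (auto simp: win_region_def)
  obtain \<tau> where \<tau>: "\<And>x. is_strategy G p (\<tau> x)"
    and \<tau>_win: "\<And>x \<pi>. x \<in> win_region G p \<Longrightarrow> is_play G x \<pi> \<Longrightarrow> conforms G p (\<tau> x) \<pi>
      \<Longrightarrow> play_won_by G p \<pi>"
    using ex_strategy[OF G, of p] by metis
  \<comment> \<open>\<open>h'\<close> is the history from the first node outside \<open>U\<close>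
    on; its head selects the strategy that takes over there.\<close>
  define \<theta> where "\<theta> h = (let h' = dropWhile (\<lambda>x. x \<in> U) h in
    if h' = [] then \<sigma> h else \<tau> (hd h') h')" for h
  have inU: "\<theta> h = \<sigma> h" if "set h \<subseteq> U" for h
  proof -
    have "dropWhile (\<lambda>x. x \<in> U) h = []" using that by auto
    then show ?thesis by (simp add: \<theta>_def)
  qed
  have "is_strategy G p \<theta>"
    unfolding is_strategy_def
  proof (intro allI impI)
    fix h assume h: "h \<noteq> [] \<and> last h \<in> own G p"
    define h' where "h' = dropWhile (\<lambda>x. x \<in> U) h"
    show "(last h, \<theta> h) \<in> edges G"
    proof (cases "h' = []")
      case True
      then have "set h \<subseteq> U" by (auto simp: h'_def)
      then have "last h \<in> own ?R p" "\<theta> h = \<sigma> h" using h inU by auto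
      then show ?thesis using \<sigma> h unfolding is_strategy_def by fastforce
    next
      case False
      then have "last h' = last h"
        unfolding h'_def by (metis last_appendR takeWhile_dropWhile_id)
      then show ?thesis using \<tau>[of "hd h'"] h False
        by (auto simp: \<theta>_def is_strategy_def Let_def h'_def[symmetric])
    qed
  qed
  moreover have "play_won_by G p \<pi>" if play: "is_play G u \<pi>" and conf: "conforms G p \<theta> \<pi>" for \<pi>
  proof (cases "\<forall>i. \<pi> i \<in> U")
    case True
    then have "is_play ?R u \<pi>" using play by (auto simp: is_play_def)
    moreover have "conforms ?R p \<sigma> \<pi>"
      unfolding conforms_def
    proof (intro allI impI)
      fix i assume "\<pi> i \<in> own ?R p"
      then have "\<pi> (Suc i) = \<theta> (map \<pi> [0..<Suc i])" using conf by (simp add: conforms_def)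
      also have "\<dots> = \<sigma> (map \<pi> [0..<Suc i])" using True by (intro inU) auto
      finally show "\<pi> (Suc i) = \<sigma> (map \<pi> [0..<Suc i])" .
    qed
    ultimately have "play_won_by ?R p \<pi>" by (rule \<sigma>_win)
    then show ?thesis by (simp add: play_won_by_def)
  next
    case False
    define j where "j = (LEAST i. \<pi> i \<notin> U)"
    have j: "\<pi> j \<notin> U" using False unfolding j_def by (metis (mono_tags, lifting) LeastI_ex)
    have j_min: "\<pi> i \<in> U" if "i < j" for i using not_less_Least[OF that[unfolded j_def]] by simp
    \<comment> \<open>The exit time is positive because the play starts at \<open>u\<close>, inside
      \<open>U\<close>.\<close>
    obtain k where k: "j = Suc k"
      using j uU play by (cases j) (auto simp: is_play_def)
    have step: "(\<pi> k, \<pi> j) \<in> edges G" using play k by (auto simp: is_play_def)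
    have prefix: "set (map \<pi> [0..<Suc k]) \<subseteq> U" using j_min k by auto
    \<comment> \<open>The strategy for the restricted game never leaves \<open>U\<close>, so the
      exit is a move of the opponent and \<open>exit\<close> applies to it.\<close>
    have "\<pi> k \<notin> own G p"
    proof
      assume "\<pi> k \<in> own G p"
      then have "\<pi> j = \<sigma> (map \<pi> [0..<Suc k])" and "\<pi> k \<in> own ?R p"
        using conf inU[OF prefix] j_min[of k] k by (auto simp: conforms_def simp del: upt_Suc)
      then have "(\<pi> k, \<pi> j) \<in> edges ?R"
        using is_strategy_prefix[OF \<sigma>, of \<pi> k] by simp
      then show False using j by simp
    qed
    then have "\<pi> k \<in> own G (opp p) \<inter> U"
      using is_play_nodes[OF G play, of k] nodes_own[of G p] j_min k by auto
    then have win: "\<pi> j \<in> win_region G p" using exit[OF step] j by auto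
    \<comment> \<open>From time \<open>j\<close> on, the truncated history is exactly the history of
      the play shifted by \<open>j\<close>, even if the play returns to \<open>U\<close>.\<close>
    have "dropWhile (\<lambda>x. x \<in> U) (map \<pi> [0..<j + Suc i]) = map (\<lambda>i. \<pi> (i + j)) [0..<Suc i]" for i
    proof -
      have "map \<pi> [0..<j + Suc i] = map \<pi> [0..<j] @ map \<pi> [j..<j + Suc i]"
        by (metis le0 map_append upt_add_eq_append)
      moreover have "map \<pi> [j..<j + Suc i] = map (\<lambda>i. \<pi> (i + j)) [0..<Suc i]"
        by (rule nth_equalityI) (simp_all add: add.commute del: upt_Suc)
      moreover have "\<dots> = \<pi> j # map (\<lambda>i. \<pi> (i + j)) [1..<Suc i]"
        by (subst upt_conv_Cons) simp_all
      moreover have "dropWhile (\<lambda>x. x \<in> U) (map \<pi> [0..<j] @ ys) = dropWhile (\<lambda>x. x \<in> U) ys" for ys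
        using j_min by (intro dropWhile_append2) auto
      ultimately show ?thesis using j by (simp del: upt_Suc)
    qed
    then have "\<theta> (map \<pi> [0..<j + Suc i]) = \<tau> (\<pi> j) (map (\<lambda>i. \<pi> (i + j)) [0..<Suc i])" for i
      unfolding \<theta>_def by (simp add: hd_map del: upt_Suc)
    then have "conforms G p (\<tau> (\<pi> j)) (\<lambda>i. \<pi> (i + j))"
      using conf unfolding conforms_def
      by (metis add_Suc_right add.commute)
    moreover have "is_play G (\<pi> j) (\<lambda>i. \<pi> (i + j))" using play by (auto simp: is_play_def)
    ultimately have "play_won_by G p (\<lambda>i. \<pi> (i + j))" using \<tau>_win win by blast
    then show ?thesis using play_won_by_shift by blast
  qed
  ultimately show "u \<in> win_region G p" using uU by (auto simp: win_region_def)
qed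


section \<open>Deleting an edge\<close>

text \<open>\<open>exit_via v w \<pi> i\<close> means that the last visit to \<open>v\<close> before time \<open>i\<close> was left towards \<open>w\<close>.
  The moves of a play are distributed over two plays accordingly, and \<open>hist v w \<pi> b i\<close> is the part
  of the prefix of length \<open>i + 1\<close> that belongs to play \<open>b\<close>.\<close>

primrec exit_via :: "'v \<Rightarrow> 'v \<Rightarrow> (nat \<Rightarrow> 'v) \<Rightarrow> nat \<Rightarrow> bool" where
  "exit_via v w \<pi> 0 = False"
| "exit_via v w \<pi> (Suc i) = (if \<pi> i = v then \<pi> (Suc i) = w else exit_via v w \<pi> i)"

definition hist :: "'v \<Rightarrow> 'v \<Rightarrow> (nat \<Rightarrow> 'v) \<Rightarrow> bool \<Rightarrow> nat \<Rightarrow> 'v list" where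
  "hist v w \<pi> b i = (if b then v else \<pi> 0) #
     map (\<lambda>j. \<pi> (Suc j)) (filter (\<lambda>j. exit_via v w \<pi> (Suc j) = b) [0..<i])"

lemma hist_not_Nil [simp]: "hist v w \<pi> b i \<noteq> []"
  by (simp add: hist_def)

lemma hist_Suc:
  "hist v w \<pi> b (Suc i) = hist v w \<pi> b i @ (if exit_via v w \<pi> (Suc i) = b then [\<pi> (Suc i)] else [])"
  by (simp add: hist_def)

text \<open>Invariant of the splitting: the active play stands at the current node and the other one
  waits at \<open>v\<close>, since the mode changes only in moves out of \<open>v\<close> and play
  \<open>True\<close> starts at \<open>v\<close>.\<close>

lemma last_hist:
  "last (hist v w \<pi> (exit_via v w \<pi> i) i) = \<pi> i \<and> last (hist v w \<pi> (\<not> exit_via v w \<pi> i) i) = v"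
proof (induction i)
  case 0
  show ?case by (simp add: hist_def)
next
  case (Suc i)
  then show ?case
    by (cases "exit_via v w \<pi> i"; cases "exit_via v w \<pi> (Suc i)")
      (auto simp: hist_Suc simp del: exit_via.simps(2) split: if_splits, auto split: if_splits)
qed

text \<open>The move out of \<open>\<pi> i\<close> is credited to the mode at \<open>Suc i\<close>.
  If this differs from the mode at \<open>i\<close>, then \<open>\<pi> i = v\<close>, which is where
  the waiting play stands.\<close>

lemma last_hist_exit_via_Suc: "last (hist v w \<pi> (exit_via v w \<pi> (Suc i)) i) = \<pi> i"
  using last_hist[of v w \<pi> i] by (cases "\<pi> i = v"; cases "exit_via v w \<pi> i"; cases "\<pi> (Suc i) = w") auto

text \<open>Dependence on the prefix only, so that a strategy can evaluate these functions on a
  finite history.\<close>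

lemma exit_via_cong: "(\<And>j. j \<le> i \<Longrightarrow> \<pi> j = \<pi>' j) \<Longrightarrow> exit_via v w \<pi> i = exit_via v w \<pi>' i"
  by (induction i) auto

lemma hist_cong:
  assumes "\<And>j. j \<le> i \<Longrightarrow> \<pi> j = \<pi>' j"
  shows "hist v w \<pi> b i = hist v w \<pi>' b i"
proof -
  have "filter (\<lambda>j. exit_via v w \<pi> (Suc j) = b) [0..<i] =
      filter (\<lambda>j. exit_via v w \<pi>' (Suc j) = b) [0..<i]"
  proof (intro filter_cong refl)
    fix j assume "j \<in> set [0..<i]"
    then have "exit_via v w \<pi> (Suc j) = exit_via v w \<pi>' (Suc j)"
      using assms by (intro exit_via_cong) simp
    then show "(exit_via v w \<pi> (Suc j) = b) = (exit_via v w \<pi>' (Suc j) = b)" by (simp only:)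
  qed
  then show ?thesis using assms by (auto simp: hist_def)
qed

section \<open>Infinite sets of moves regarded as plays of their own\<close>

lemma filter_upt_enumerate:
  fixes A :: "nat set"
  assumes "infinite A"
  shows "filter (\<lambda>j. j \<in> A) [0..<enumerate A n] = map (enumerate A) [0..<n]"
proof (rule sorted_distinct_set_unique)
  have mono: "strict_mono (enumerate A)"
    using assms by (simp add: strict_mono_enumerate)
  show "sorted (map (enumerate A) [0..<n])"
    by (auto simp: sorted_iff_nth_mono strict_mono_less_eq[OF mono])
  show "sorted (filter (\<lambda>j. j \<in> A) [0..<enumerate A n])"
    by (intro sorted_wrt_filter sorted_upt)
  show "distinct (map (enumerate A) [0..<n])"
    using strict_mono_imp_inj_on[OF mono] by (simp add: distinct_map inj_on_subset)
  show "set (filter (\<lambda>j. j \<in> A) [0..<enumerate A n]) = set (map (enumerate A) [0..<n])"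
  proof (intro set_eqI iffI)
    fix j assume "j \<in> set (filter (\<lambda>j. j \<in> A) [0..<enumerate A n])"
    then have j: "j \<in> A" "j < enumerate A n" by auto
    obtain k where "enumerate A k = j" using enumerate_Ex[OF assms j(1)] by blast
    then show "j \<in> set (map (enumerate A) [0..<n])"
      using j(2) strict_mono_less[OF mono] by auto
  next
    fix j assume "j \<in> set (map (enumerate A) [0..<n])"
    then show "j \<in> set (filter (\<lambda>j. j \<in> A) [0..<enumerate A n])"
      using strict_mono_less[OF mono] enumerate_in_set[OF assms] by auto
  qed
qed auto

text \<open>The moves at times in \<open>A\<close> contribute their targets, which is why the
  starting node \<open>x\<close> is supplied separately.\<close>

definition subplay :: "'v \<Rightarrow> nat set \<Rightarrow> (nat \<Rightarrow> 'v) \<Rightarrow> nat \<Rightarrow> 'v" where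
  "subplay x A \<pi> n = (case n of 0 \<Rightarrow> x | Suc k \<Rightarrow> \<pi> (Suc (enumerate A k)))"

text \<open>Just before its move number \<open>n\<close>, counted from 0, play \<open>b\<close> has
  made \<open>n\<close> moves, so its history has \<open>n + 1\<close> nodes.\<close>

lemma hist_enumerate:
  assumes "infinite A" "A = {j. exit_via v w \<pi> (Suc j) = b}"
  shows "hist v w \<pi> b (enumerate A n) = map (subplay (if b then v else \<pi> 0) A \<pi>) [0..<Suc n]"
proof -
  have "filter (\<lambda>j. exit_via v w \<pi> (Suc j) = b) [0..<enumerate A n] = map (enumerate A) [0..<n]"
    using filter_upt_enumerate[OF assms(1), of n] assms(2) by simp
  then show ?thesis
    unfolding hist_def
    by (subst upt_conv_Cons) (simp_all add: subplay_def map_Suc_upt[symmetric] del: upt_Suc exit_via.simps)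
qed

text \<open>\<open>enumerate A\<close> is a bijection onto \<open>A\<close>, and the starting node
  affects a single index.\<close>

lemma infinite_subplay:
  assumes "infinite A"
  shows "infinite {n. P (subplay x A \<pi> n)} \<longleftrightarrow> infinite {i \<in> A. P (\<pi> (Suc i))}"
proof -
  have inj: "inj (enumerate A)" using assms by (simp add: strict_mono_enumerate strict_mono_imp_inj_on)
  have "{i \<in> A. P (\<pi> (Suc i))} = enumerate A ` {n. P (\<pi> (Suc (enumerate A n)))}"
    using enumerate_Ex[OF assms] enumerate_in_set[OF assms] assms by auto
  then have "finite {i \<in> A. P (\<pi> (Suc i))} \<longleftrightarrow> finite {n. P (\<pi> (Suc (enumerate A n)))}"
    using inj by (simp add: finite_image_iff inj_on_subset)
  then show ?thesis
    using infinite_seg[of "\<lambda>n. P (subplay x A \<pi> n)" 1] by (simp add: subplay_def)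
qed

text \<open>The minimum of a union is the minimum of one of the parts. That part is asserted to be
  nonempty because \<open>LEAST\<close> is arbitrary on an empty one.\<close>

lemma Least_disj:
  fixes P Q :: "nat \<Rightarrow> bool"
  assumes "\<exists>k. P k \<or> Q k"
  shows "(\<exists>k. P k) \<and> (LEAST k. P k \<or> Q k) = (LEAST k. P k) \<or>
    (\<exists>k. Q k) \<and> (LEAST k. P k \<or> Q k) = (LEAST k. Q k)"
proof -
  let ?k = "LEAST k. P k \<or> Q k"
  have min: "?k \<le> k" if "P k \<or> Q k" for k using that by (rule Least_le)
  have "P ?k \<or> Q ?k" using assms by (rule LeastI_ex)
  moreover have "?k = (LEAST k. P k)" if "P ?k"
    using that min by (intro Least_equality[symmetric]) auto
  moreover have "?k = (LEAST k. Q k)" if "Q ?k"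
    using that min by (intro Least_equality[symmetric]) auto
  ultimately show ?thesis by blast
qed

text \<open>A colour recurs in \<open>\<pi>\<close> iff it recurs within one of the two classes of
  moves, so the least recurring colour is the least one of some class. A finite class has no
  recurring colour and imposes no condition.\<close>

lemma play_won_by_interleave:
  fixes m :: "nat \<Rightarrow> bool"
  assumes G: "parity_game G" and play: "is_play G u \<pi>"
    and won: "\<And>b. infinite {i. m i = b} \<Longrightarrow> play_won_by G p (subplay (x b) {i. m i = b} \<pi>)"
  shows "play_won_by G p \<pi>"
proof -
  define I where "I b k \<longleftrightarrow> infinite {i \<in> {i. m i = b}. colour G (\<pi> (Suc i)) = k}" for b k
  have split: "infinite {i. colour G (\<pi> i) = k} \<longleftrightarrow> I True k \<or> I False k" for k
  proof -
    have "{i. colour G (\<pi> (Suc i)) = k} = {i \<in> {i. m i = True}. colour G (\<pi> (Suc i)) = k}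
        \<union> {i \<in> {i. m i = False}. colour G (\<pi> (Suc i)) = k}" by auto
    then have "infinite {i. colour G (\<pi> (Suc i)) = k} \<longleftrightarrow> I True k \<or> I False k"
      unfolding I_def by (simp only: finite_Un de_Morgan_conj)
    then show ?thesis
      using infinite_seg[of "\<lambda>i. colour G (\<pi> i) = k" 1] by (simp only: Suc_eq_plus1)
  qed
  have good: "even (LEAST k. I b k) \<longleftrightarrow> p = P0" if "\<exists>k. I b k" for b
  proof -
    have inf: "infinite {i. m i = b}" using that unfolding I_def by fastforce
    show ?thesis
      using won[OF inf] infinite_subplay[OF inf, of "\<lambda>y. colour G y = _"]
      unfolding play_won_by_def I_def by simp
  qed
  \<comment> \<open>Some colour recurs, by the pigeonhole principle; otherwise the
    \<open>LEAST\<close> in the winning condition would be arbitrary.\<close>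
  have "range (\<lambda>i. colour G (\<pi> i)) \<subseteq> colour G ` nodes G"
    using is_play_nodes[OF G play] by blast
  then have "finite (range (\<lambda>i. colour G (\<pi> i)))"
    using G finite_surj by (auto simp: parity_game_def)
  then obtain k where "infinite {i. colour G (\<pi> i) = k}"
    using pigeonhole_infinite[of UNIV "\<lambda>i. colour G (\<pi> i)"] by auto
  then have "\<exists>k. I True k \<or> I False k" using split by blast
  from Least_disj[OF this] good show ?thesis unfolding play_won_by_def split by metis
qed

text \<open>If the owner of \<open>v\<close> loses from \<open>v\<close> when always moving to \<open>w\<close>, then the opponent
  plays the winning strategies of the two games \<open>G \ e\<close> and \<open>G\<^sub>e\<close> in parallel, each on the
  moves of the play that belong to it.\<close>

lemma win_region_del_edge_opp:
  assumes G: "parity_game G" and v: "v \<in> own G (opp p)"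
    and v_win: "v \<in> win_region (fix_edge G (v, w)) p"
  shows "win_region (del_edge G (v, w)) p \<subseteq> win_region G p"
proof
  fix u assume u: "u \<in> win_region (del_edge G (v, w)) p"
  \<comment> \<open>Play \<open>True\<close> takes place in the game with the fixed edge and starts
    at \<open>v\<close>; play \<open>False\<close> takes place in the game without the edge and
    starts at \<open>u\<close>.\<close>
  define K where "K b = (if b then fix_edge G (v, w) else del_edge G (v, w))" for b
  define x where "x b = (if b then v else u)" for b
  have K [simp]: "own (K b) = own G" "colour (K b) = colour G" "edges (K b) \<subseteq> edges G" for b
    by (auto simp: K_def)
  have "\<exists>\<sigma>. is_strategy (K b) p \<sigma> \<and>
     (\<forall>\<pi>. is_play (K b) (x b) \<pi> \<and> conforms (K b) p \<sigma> \<pi> \<longrightarrow> play_won_by (K b) p \<pi>)" for b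
    using u v_win by (auto simp: K_def x_def win_region_def)
  then obtain \<sigma> where \<sigma>: "\<And>b. is_strategy (K b) p (\<sigma> b)"
    and \<sigma>_win: "\<And>b \<pi>. is_play (K b) (x b) \<pi> \<Longrightarrow> conforms (K b) p (\<sigma> b) \<pi> \<Longrightarrow> play_won_by (K b) p \<pi>"
    by metis
  have v_own: "v \<notin> own G p" using v own_disjoint[OF G, of p] by auto
  \<comment> \<open>The history is read as a play through \<open>nth\<close>; the arbitrary values
    beyond its end do not influence \<open>exit_via\<close> and \<open>hist\<close> at
    \<open>n\<close>.\<close>
  define \<theta> where "\<theta> h = (let n = length h - 1; b = exit_via v w (nth h) n
    in \<sigma> b (hist v w (nth h) b n))" for h
  have \<theta>_map: "\<theta> (map \<pi> [0..<Suc i]) =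
    \<sigma> (exit_via v w \<pi> i) (hist v w \<pi> (exit_via v w \<pi> i) i)" for \<pi> i
  proof -
    have nth: "map \<pi> [0..<Suc i] ! j = \<pi> j" if "j \<le> i" for j
      using that by (simp del: upt_Suc)
    have "exit_via v w (nth (map \<pi> [0..<Suc i])) i = exit_via v w \<pi> i"
      using nth by (intro exit_via_cong)
    moreover have "hist v w (nth (map \<pi> [0..<Suc i])) b i = hist v w \<pi> b i" for b
      using nth by (intro hist_cong)
    ultimately show ?thesis by (simp add: \<theta>_def Let_def del: upt_Suc)
  qed
  have "is_strategy G p \<theta>"
    unfolding is_strategy_def
  proof (intro allI impI)
    fix h assume h: "h \<noteq> [] \<and> last h \<in> own G p"
    define n where "n = length h - 1"
    define b where "b = exit_via v w (nth h) n"
    have "last (hist v w (nth h) b n) = last h"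
      using last_hist[of v w "nth h" n] h by (simp add: b_def n_def last_conv_nth)
    moreover have "\<theta> h = \<sigma> b (hist v w (nth h) b n)" by (simp add: \<theta>_def n_def b_def Let_def)
    ultimately have "(last h, \<theta> h) \<in> edges (K b)"
      using \<sigma>[of b] h unfolding is_strategy_def by (metis K(1) hist_not_Nil)
    then show "(last h, \<theta> h) \<in> edges G" using K(3) by blast
  qed
  moreover have "play_won_by G p \<pi>" if play: "is_play G u \<pi>" and conf: "conforms G p \<theta> \<pi>" for \<pi>
  proof (rule play_won_by_interleave[OF G play])
    fix b
    define A where "A = {i. exit_via v w \<pi> (Suc i) = b}"
    define \<alpha> where "\<alpha> = subplay (x b) A \<pi>"
    assume "infinite {i. exit_via v w \<pi> (Suc i) = b}"
    then have A: "infinite A" by (simp add: A_def)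
    have \<alpha>0: "\<alpha> 0 = x b" by (simp add: \<alpha>_def subplay_def)
    have \<alpha>Suc: "\<alpha> (Suc n) = \<pi> (Suc (enumerate A n))" for n by (simp add: \<alpha>_def subplay_def)
    have "(if b then v else \<pi> 0) = x b" using play by (simp add: x_def is_play_def)
    then have hist: "hist v w \<pi> b (enumerate A n) = map \<alpha> [0..<Suc n]" for n
      using hist_enumerate[OF A A_def, of n] by (simp add: \<alpha>_def)
    have mode: "exit_via v w \<pi> (Suc (enumerate A n)) = b" for n
      using enumerate_in_set[OF A, of n] by (auto simp: A_def)
    \<comment> \<open>Apart from the start, \<open>\<alpha> n\<close> was introduced as the target
      of a move. It is also the source of the next move of this play, which waits at
      \<open>v\<close> while the other one is active.\<close>
    have \<alpha>: "\<alpha> n = \<pi> (enumerate A n)" for n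
      using last_hist_exit_via_Suc[of v w \<pi> "enumerate A n"] unfolding mode hist by simp
    have "is_play (K b) (x b) \<alpha>"
      unfolding is_play_def
    proof (intro conjI allI)
      fix n
      have "(\<alpha> n, \<alpha> (Suc n)) \<in> edges G"
        unfolding \<alpha>[of n] \<alpha>Suc using play by (simp add: is_play_def)
      \<comment> \<open>A move out of \<open>v\<close> has mode \<open>True\<close> exactly if it
        goes to \<open>w\<close>.\<close>
      then show "(\<alpha> n, \<alpha> (Suc n)) \<in> edges (K b)"
        using mode[of n] unfolding \<alpha>Suc \<alpha>[of n] by (cases b) (auto simp: K_def)
    qed (rule \<alpha>0)
    moreover have "conforms (K b) p (\<sigma> b) \<alpha>"
      unfolding conforms_def
    proof (intro allI impI)
      fix n assume "\<alpha> n \<in> own (K b) p"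
      then have own: "\<pi> (enumerate A n) \<in> own G p" by (simp add: \<alpha>)
      \<comment> \<open>Since \<open>v\<close> belongs to the opponent, the mode does not change at
        a node of \<open>p\<close>; hence \<open>\<theta>\<close> consults the strategy of the play
        that receives the move.\<close>
      then have b: "exit_via v w \<pi> (enumerate A n) = b"
        using mode[of n] v_own by (metis exit_via.simps(2))
      have "\<pi> (Suc (enumerate A n)) = \<theta> (map \<pi> [0..<Suc (enumerate A n)])"
        using conf own by (simp add: conforms_def)
      then show "\<alpha> (Suc n) = \<sigma> b (map \<alpha> [0..<Suc n])"
        unfolding \<theta>_map b hist \<alpha>Suc .
    qed
    ultimately have "play_won_by (K b) p \<alpha>" by (rule \<sigma>_win)
    then show "play_won_by G p (subplay (x b) {i. exit_via v w \<pi> (Suc i) = b} \<pi>)"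
      by (simp add: play_won_by_def \<alpha>_def A_def del: exit_via.simps)
  qed
  ultimately show "u \<in> win_region G p" using u by (auto simp: win_region_def)
qed

text \<open>A strategy of \<open>p\<close> for the smaller game never uses the deleted edge, so the
  plays of \<open>G\<close> conforming to it already lie in the smaller game.\<close>

lemma win_region_del_edge_owner:
  assumes G: "parity_game G" and v: "v \<in> own G p"
  shows "win_region (del_edge G (v, w)) p \<subseteq> win_region G p"
proof
  let ?D = "del_edge G (v, w)"
  fix u assume u: "u \<in> win_region ?D p"
  then obtain \<sigma> where \<sigma>: "is_strategy ?D p \<sigma>"
    and win: "\<And>\<pi>. is_play ?D u \<pi> \<Longrightarrow> conforms ?D p \<sigma> \<pi> \<Longrightarrow> play_won_by ?D p \<pi>"
    by (auto simp: win_region_def)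
  have "play_won_by G p \<pi>" if play: "is_play G u \<pi>" and conf: "conforms G p \<sigma> \<pi>" for \<pi>
  proof -
    have "(\<pi> i, \<pi> (Suc i)) \<in> edges ?D" for i
    proof (cases "\<pi> i = v")
      case True
      then have "\<pi> (Suc i) = \<sigma> (map \<pi> [0..<Suc i])" using conf v by (simp add: conforms_def)
      then show ?thesis using is_strategy_prefix[OF \<sigma>, of \<pi> i] True v by simp
    next
      case False
      then show ?thesis using play by (auto simp: is_play_def)
    qed
    then have "is_play ?D u \<pi>" using play by (auto simp: is_play_def)
    moreover have "conforms ?D p \<sigma> \<pi>" using conf by (simp add: conforms_def)
    ultimately show ?thesis using win by (fastforce simp: play_won_by_def)
  qed
  moreover have "is_strategy G p \<sigma>" using \<sigma> by (auto simp: is_strategy_def)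
  ultimately show "u \<in> win_region G p" using u by (auto simp: win_region_def)
qed


section \<open>Runs of the transformation\<close>

definition subgame :: "'v game \<Rightarrow> 'v game \<Rightarrow> bool" where
  "subgame H G \<longleftrightarrow> nodes H \<subseteq> nodes G \<and> edges H \<subseteq> edges G \<and> colour H = colour G"

lemma subgame_trans: "subgame H G \<Longrightarrow> subgame G K \<Longrightarrow> subgame H K"
  by (auto simp: subgame_def)

lemma subgame_refl [simp]: "subgame G G"
  and subgame_restrict_game [simp]: "subgame (restrict_game G U) G"
  and subgame_fix_edge [simp]: "subgame (fix_edge G e) G"
  and subgame_del_edge [simp]: "subgame (del_edge G e) G"
  by (auto simp: subgame_def)

text \<open>This is |E| - |V| for parity games. As a sum of natural numbers over nodes it is visibly
  monotone, although both cardinalities shrink in a sub-game.\<close>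

definition excess :: "'v game \<Rightarrow> nat" where
  "excess G = (\<Sum>v \<in> nodes G. card (succs G v) - 1)"

lemma card_edges:
  assumes "parity_game G"
  shows "card (edges G) = card (nodes G) + excess G"
proof -
  have fin: "finite (nodes G)" using assms by (simp add: parity_game_def)
  have "card (edges G) = card (SIGMA v : nodes G. succs G v)"
    using assms by (intro arg_cong[of _ _ card]) (auto simp: parity_game_def succs_def)
  also have "\<dots> = (\<Sum>v \<in> nodes G. card (succs G v))"
    using fin parity_game_finite_succs[OF assms] by (simp add: card_SigmaI)
  also have "\<dots> = (\<Sum>v \<in> nodes G. 1 + (card (succs G v) - 1))"
    using assms parity_game_finite_succs[OF assms]
    by (intro sum.cong refl) (auto simp: parity_game_def Suc_leI card_gt_0_iff)
  finally show ?thesis unfolding sum.distrib excess_def by simp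
qed

lemma excess_mono:
  assumes "parity_game G" "subgame H G"
  shows "excess H \<le> excess G"
proof -
  have sub: "nodes H \<subseteq> nodes G" "\<And>v. succs H v \<subseteq> succs G v"
    using assms(2) by (auto simp: subgame_def succs_def)
  have "excess H \<le> (\<Sum>v \<in> nodes H. card (succs G v) - 1)"
    unfolding excess_def using sub(2) parity_game_finite_succs[OF assms(1)]
    by (intro sum_mono diff_le_mono card_mono) auto
  also have "\<dots> \<le> excess G"
    unfolding excess_def using sub(1) assms(1) by (intro sum_mono2) (auto simp: parity_game_def)
  finally show ?thesis .
qed

lemma excess_del_edge:
  assumes "parity_game G" "(v, w) \<in> edges G" "card (succs G v) > 1"
  shows "Suc (excess (del_edge G (v, w))) = excess G"
proof -
  have "Suc (card (edges (del_edge G (v, w)))) = card (edges G)"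
    using assms card_Suc_Diff1[OF parity_game_finite_edges, of G] by simp
  then show ?thesis
    using card_edges[OF assms(1)] card_edges[OF parity_game_del_edge[OF assms(1,3), of w]] by simp
qed

lemma set_loop_edges:
  assumes "valid_schedule S" "parity_game G" "e \<in> set (loop_edges S G)"
  shows "e \<in> edges G" "card (succs G (fst e)) > 1"
  using assms by (auto simp: loop_edges_def valid_schedule_def succs_def)

text \<open>A node of out-degree d > 1 contributes d tests, and d \<le> 2 (d - 1).\<close>

lemma length_loop_edges:
  assumes "valid_schedule S" "parity_game G"
  shows "length (loop_edges S G) \<le> 2 * excess G"
proof -
  have S: "distinct (node_seq S G)" "set (node_seq S G) = nodes G"
    "\<And>v. v \<in> nodes G \<Longrightarrow> distinct (succ_seq S G v) \<and> set (succ_seq S G v) = succs G v"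
    using assms by (auto simp: valid_schedule_def)
  have len: "length (succ_seq S G v) = card (succs G v)" if "v \<in> nodes G" for v
    using S(3)[OF that] distinct_card by fastforce
  let ?B = "{v \<in> nodes G. card (succs G v) > 1}"
  have "length (loop_edges S G) = (\<Sum>v \<in> ?B. length (succ_seq S G v))"
    using S(1,2) by (simp add: loop_edges_def length_concat comp_def sum_list_distinct_conv_sum_set)
  also have "\<dots> \<le> (\<Sum>v \<in> ?B. 2 * (card (succs G v) - 1))"
    by (intro sum_mono) (auto simp: len)
  also have "\<dots> \<le> (\<Sum>v \<in> nodes G. 2 * (card (succs G v) - 1))"
    using assms(2) by (intro sum_mono2) (auto simp: parity_game_def)
  finally show ?thesis by (simp add: excess_def sum_distrib_left)
qed

lemma residual_restrict:
  assumes "partial_solver \<rho>" "parity_game G"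
  obtains U where "U \<subseteq> nodes G" "residual \<rho> G = restrict_game G U" "parity_game (residual \<rho> G)"
    "\<And>p. win \<rho> G p \<union> win \<rho> G (opp p) = nodes G - U"
proof -
  obtain U where U: "U \<subseteq> nodes G" "residual \<rho> G = restrict_game G U" "parity_game (residual \<rho> G)"
    "win \<rho> G P0 \<union> win \<rho> G P1 = nodes G - U"
    using assms(1)[unfolded partial_solver_def, rule_format, OF assms(2)] by (elim bexE exE conjE)
  moreover have "win \<rho> G p \<union> win \<rho> G (opp p) = nodes G - U" for p
    using U(4) by (cases p) auto
  ultimately show ?thesis using that by blast
qed

lemma parity_game_residual: "partial_solver \<rho> \<Longrightarrow> parity_game G \<Longrightarrow> parity_game (residual \<rho> G)"
  and subgame_residual: "partial_solver \<rho> \<Longrightarrow> parity_game G \<Longrightarrow> subgame (residual \<rho> G) G"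
  by (metis residual_restrict subgame_restrict_game)+

text \<open>Induction along the recursion, with termination as part of the conclusion;
  \<open>excess\<close> is the decreasing measure. The list \<open>es\<close> holds the edges tested
  in one invocation, including the successful one in case \<open>step\<close>.\<close>

lemma lift_run_induct [consumes 3, case_names stop step]:
  fixes P :: "'v game \<Rightarrow> 'v run \<Rightarrow> bool"
  assumes \<rho>: "partial_solver \<rho>" and S: "valid_schedule S" and G: "parity_game G"
    and stop: "\<And>G r es. parity_game G \<Longrightarrow> main_calls r = [G] \<Longrightarrow>
      loop_calls r = map (fix_edge (residual \<rho> G)) es \<Longrightarrow>
      set es \<subseteq> set (loop_edges S (residual \<rho> G)) \<Longrightarrow>
      length es \<le> length (loop_edges S (residual \<rho> G)) \<Longrightarrow> P G r"
    and step: "\<And>G r r' e es. parity_game G \<Longrightarrow> e \<in> set es \<Longrightarrow>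
      test_succeeds \<rho> (residual \<rho> G) e \<Longrightarrow> P (del_edge (residual \<rho> G) e) r' \<Longrightarrow>
      main_calls r = G # main_calls r' \<Longrightarrow>
      loop_calls r = map (fix_edge (residual \<rho> G)) es @ loop_calls r' \<Longrightarrow>
      set es \<subseteq> set (loop_edges S (residual \<rho> G)) \<Longrightarrow>
      length es \<le> length (loop_edges S (residual \<rho> G)) \<Longrightarrow> P G r"
  shows "\<exists>r. lift_run S \<rho> G = Some r \<and> P G r"
  using G
proof (induction "excess G" arbitrary: G rule: less_induct)
  case less
  define H where "H = residual \<rho> G"
  define fs where "fs = takeWhile (\<lambda>e. \<not> test_succeeds \<rho> H e) (loop_edges S H)"
  define ss where "ss = dropWhile (\<lambda>e. \<not> test_succeeds \<rho> H e) (loop_edges S H)"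
  have H: "parity_game H" unfolding H_def using \<rho> less.prems by (rule parity_game_residual)
  have fs_ss: "fs @ ss = loop_edges S H" by (simp add: fs_def ss_def)
  have run: "lift_run S \<rho> G = (case ss of
      [] \<Rightarrow> Some \<lparr>main_calls = [G], loop_calls = map (fix_edge H) fs, final_game = H\<rparr>
    | e # _ \<Rightarrow> Option.bind (lift_run S \<rho> (del_edge H e))
        (\<lambda>r. Some \<lparr>main_calls = G # main_calls r,
          loop_calls = map (fix_edge H) (fs @ [e]) @ loop_calls r, final_game = final_game r\<rparr>))"
    unfolding fs_def ss_def H_def by (subst lift_run.simps) (simp only: Let_def)
  show ?case
  proof (cases ss)
    case Nil
    then have "fs = loop_edges S H" using fs_ss by simp
    then have "P G \<lparr>main_calls = [G], loop_calls = map (fix_edge H) fs, final_game = H\<rparr>"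
      using less.prems by (intro stop[where es = fs]) (simp_all add: H_def)
    then show ?thesis using run Nil by simp
  next
    case (Cons e ss')
    have es: "set (fs @ [e]) \<subseteq> set (loop_edges S H)" "length (fs @ [e]) \<le> length (loop_edges S H)"
      using Cons by (auto simp: fs_ss[symmetric])
    have test: "test_succeeds \<rho> H e"
      using Cons hd_dropWhile[of "\<lambda>e. \<not> test_succeeds \<rho> H e" "loop_edges S H"]
      by (simp add: ss_def)
    obtain v w where e: "e = (v, w)" by (cases e)
    then have deg: "(v, w) \<in> edges H" "card (succs H v) > 1"
      using set_loop_edges[OF S H, of e] es by auto
    have "excess (del_edge H e) < excess G"
      using excess_del_edge[OF H deg] excess_mono[OF less.prems subgame_residual[OF \<rho> less.prems]]
      by (simp add: e H_def)
    moreover have "parity_game (del_edge H e)" using parity_game_del_edge[OF H deg(2)] e by simp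
    ultimately obtain r' where r': "lift_run S \<rho> (del_edge H e) = Some r'" "P (del_edge H e) r'"
      using less.hyps by blast
    define r where "r = \<lparr>main_calls = G # main_calls r',
      loop_calls = map (fix_edge H) (fs @ [e]) @ loop_calls r', final_game = final_game r'\<rparr>"
    have "lift_run S \<rho> G = Some r" using run Cons r' by (simp add: r_def)
    moreover have "P G r"
    proof (rule step[OF less.prems])
      show "e \<in> set (fs @ [e])" by simp
      show "main_calls r = G # main_calls r'" by (simp add: r_def)
      show "loop_calls r = map (fix_edge (residual \<rho> G)) (fs @ [e]) @ loop_calls r'"
        by (simp add: r_def H_def)
    qed (fact test[unfolded H_def] r'(2)[unfolded H_def] es[unfolded H_def])+
    ultimately show ?thesis by blast
  qed
qed

text \<open>There are at most \<open>1 + excess G\<close> invocations, each with one main call and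
  at most \<open>2 * excess G\<close> loop calls.\<close>

lemma lift_run_calls:
  assumes \<rho>: "partial_solver \<rho>" and S: "valid_schedule S" and G: "parity_game G"
  shows "\<exists>r. lift_run S \<rho> G = Some r \<and>
    (\<forall>H \<in> set (main_calls r @ loop_calls r). parity_game H \<and> subgame H G) \<and>
    length (main_calls r @ loop_calls r) \<le> (1 + 2 * excess G) * (1 + excess G)"
  using assms
proof (induction rule: lift_run_induct)
  case (stop G r es)
  note res = parity_game_residual[OF \<rho> stop(1)] subgame_residual[OF \<rho> stop(1)]
  have "length es \<le> 2 * excess G"
    using stop(5) length_loop_edges[OF S res(1)] excess_mono[OF stop(1) res(2)] by linarith
  moreover have "parity_game (fix_edge (residual \<rho> G) e)" if "e \<in> set es" for e
    using that stop(4) set_loop_edges(1)[OF S res(1)] parity_game_fix_edge[OF res(1)] by blast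
  moreover have "subgame (fix_edge (residual \<rho> G) e) G" for e
    using res(2) subgame_fix_edge subgame_trans by blast
  ultimately show ?case using stop(1-3) by auto
next
  case (step G r r' e es)
  let ?H = "residual \<rho> G"
  note res = parity_game_residual[OF \<rho> step(1)] subgame_residual[OF \<rho> step(1)]
  have exc: "excess ?H \<le> excess G" by (rule excess_mono[OF step(1) res(2)])
  have "length es \<le> 2 * excess G"
    using step(8) length_loop_edges[OF S res(1)] exc by linarith
  obtain v w where e: "e = (v, w)" by (cases e)
  have "Suc (excess (del_edge ?H e)) \<le> excess G"
    using excess_del_edge[OF res(1), of v w] set_loop_edges[OF S res(1), of e] step(2,7) exc e by auto
  then obtain k where k: "excess G = Suc k" "excess (del_edge ?H e) \<le> k"
    by (cases "excess G") auto
  have "length (main_calls r' @ loop_calls r') \<le> (1 + 2 * k) * (1 + k)"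
    using step(4) mult_le_mono[of "1 + 2 * excess (del_edge ?H e)" "1 + 2 * k"
        "1 + excess (del_edge ?H e)" "1 + k"] k(2) by linarith
  then have "length (main_calls r @ loop_calls r) \<le> (1 + 2 * excess G) * (1 + excess G)"
    using \<open>length es \<le> 2 * excess G\<close> k(1) step(5,6) by (simp add: algebra_simps)
  moreover have "parity_game (fix_edge ?H e')" if "e' \<in> set es" for e'
    using that step(7) set_loop_edges(1)[OF S res(1)] parity_game_fix_edge[OF res(1)] by blast
  moreover have "subgame (fix_edge ?H e') G" for e'
    using res(2) subgame_fix_edge subgame_trans by blast
  moreover have "subgame K G" if "subgame K (del_edge ?H e)" for K
    using that res(2) subgame_del_edge subgame_trans by blast
  ultimately show ?case using step(1,4,5,6) by auto
qed


section \<open>Soundness\<close>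

text \<open>If the opponent could move from the residual game to a node classified as won by the
  opponent, attractor closure would have removed the source as well. So every exit leads into the
  winning region of \<open>p\<close>.\<close>

lemma win_region_residual:
  assumes \<rho>: "partial_solver \<rho>" "soundness \<rho>" "removes_attractors \<rho>" and G: "parity_game G"
  shows "win_region (residual \<rho> G) p \<subseteq> win_region G p"
proof -
  obtain U where U: "residual \<rho> G = restrict_game G U"
    and win: "\<And>p. win \<rho> G p \<union> win \<rho> G (opp p) = nodes G - U"
    using residual_restrict[OF \<rho>(1) G] by metis
  have "y \<in> U \<union> win_region G p" if xy: "(x, y) \<in> edges G" and x: "x \<in> own G (opp p) \<inter> U" for x y
  proof (rule ccontr)
    assume y: "\<not> ?thesis"
    then have "y \<notin> win \<rho> G p" using \<rho>(2) G by (auto simp: soundness_def)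
    moreover have "y \<in> nodes G" using G xy by (auto simp: parity_game_def)
    ultimately have "y \<in> win \<rho> G (opp p)" using win[of p] y by auto
    then have "x \<in> win \<rho> G (opp p)"
      using \<rho>(3) G xy x unfolding removes_attractors_def attractor_closed_def succs_def by blast
    then show False using win[of p] x by auto
  qed
  then show ?thesis unfolding U by (intro win_region_restrict_game[OF G])
qed

text \<open>By idempotency a second application removes no node, and the classified nodes are the
  removed ones. This supplies the emptiness premise of \<open>locality\<close>.\<close>

lemma win_residual_empty:
  assumes "partial_solver \<rho>" "idempotency \<rho>" and G: "parity_game G"
  shows "win \<rho> (residual \<rho> G) p = {}"
proof -
  let ?H = "residual \<rho> G"
  obtain U where U: "residual \<rho> ?H = restrict_game ?H U"
    and win: "\<And>p. win \<rho> ?H p \<union> win \<rho> ?H (opp p) = nodes ?H - U"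
    using residual_restrict[OF assms(1) parity_game_residual[OF assms(1) G]] by metis
  have "restrict_game ?H U = ?H" using assms(2) G U unfolding idempotency_def by metis
  then have "nodes ?H \<subseteq> U" by (metis Int_lower2 restrict_game_simps(3))
  then show ?thesis using win[of p] by auto
qed

lemma soundness_lift:
  assumes \<rho>: "partial_solver \<rho>" "soundness \<rho>" "removes_attractors \<rho>" "idempotency \<rho>" "locality \<rho>"
    and S: "valid_schedule S"
  shows "soundness (lift S \<rho>)"
proof -
  have "\<exists>r. lift_run S \<rho> G = Some r \<and> (\<forall>H \<in> set (main_calls r). \<forall>p. win \<rho> H p \<subseteq> win_region G p)"
    if "parity_game G" for G
    using \<rho>(1) S that
  proof (induction rule: lift_run_induct)
    case (stop G r es)
    then show ?case using \<rho>(2) by (simp add: soundness_def)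
  next
    case (step G r r' e es)
    let ?H = "residual \<rho> G"
    have H: "parity_game ?H" using \<rho>(1) step(1) by (rule parity_game_residual)
    obtain v w where e: "e = (v, w)" by (cases e)
    have vw: "(v, w) \<in> edges ?H" using set_loop_edges(1)[OF S H, of e] step(2,7) e by auto
    then have "v \<in> nodes ?H" using H by (auto simp: parity_game_def)
    define p where "p = owner ?H v"
    have v: "v \<in> own ?H p" unfolding p_def using \<open>v \<in> nodes ?H\<close> by (rule owner_own)
    \<comment> \<open>The successful test only says that some node is classified; locality turns
      this into a statement about \<open>v\<close> itself.\<close>
    have "v \<in> win \<rho> (fix_edge ?H (v, w)) (opp p)"
      using \<rho>(5) H vw v win_residual_empty[OF \<rho>(1,4) step(1)] step(3)
      unfolding locality_def test_succeeds_def e p_def by simp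
    then have v_win: "v \<in> win_region (fix_edge ?H (v, w)) (opp p)"
      using \<rho>(2) parity_game_fix_edge[OF H vw] unfolding soundness_def by blast
    have "win_region (del_edge ?H (v, w)) (opp p) \<subseteq> win_region ?H (opp p)"
      using v v_win by (intro win_region_del_edge_opp[OF H]) simp_all
    moreover have "win_region (del_edge ?H (v, w)) p \<subseteq> win_region ?H p"
      using v by (rule win_region_del_edge_owner[OF H])
    ultimately have del: "win_region (del_edge ?H e) q \<subseteq> win_region ?H q" for q
      unfolding e by (cases p; cases q) auto
    have "win_region (del_edge ?H e) q \<subseteq> win_region G q" for q
      using del[of q] win_region_residual[OF \<rho>(1-3) step(1), of q] by blast
    moreover have "win \<rho> G q \<subseteq> win_region G q" for q
      using \<rho>(2) step(1) by (simp add: soundness_def)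
    ultimately show ?case using step(4,5) by auto blast+
  qed
  then show ?thesis unfolding soundness_def lift_def by fastforce
qed


section \<open>Running time\<close>

lemma
  assumes G: "parity_game G" and H: "subgame H G"
  shows card_nodes_subgame: "card (nodes H) \<le> card (nodes G)"
    and card_edges_subgame: "card (edges H) \<le> card (edges G)"
    and max_colour_subgame: "max_colour H \<le> max_colour G"
    and input_length_subgame: "input_length H \<le> input_length G"
proof -
  have sub: "nodes H \<subseteq> nodes G" "edges H \<subseteq> edges G" "colour H = colour G"
    using H by (auto simp: subgame_def)
  have fin: "finite (nodes G)" using G by (simp add: parity_game_def)
  show nodes: "card (nodes H) \<le> card (nodes G)" using fin sub(1) by (rule card_mono)
  show edges: "card (edges H) \<le> card (edges G)"
    using parity_game_finite_edges[OF G] sub(2) by (rule card_mono)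
  show "max_colour H \<le> max_colour G"
    unfolding max_colour_def using sub fin by (intro Max_mono) auto
  have "(\<Sum>v \<in> nodes H. floorlog 2 (colour H v)) \<le> (\<Sum>v \<in> nodes G. floorlog 2 (colour G v))"
    unfolding sub(3) using fin sub(1) by (intro sum_mono2) auto
  then show "input_length H \<le> input_length G" using nodes edges by (simp add: input_length_def)
qed

text \<open>\<open>T\<close> may be larger on a sub-game than on \<open>G\<close>, so calls are
  compared with the worst case within the size parameters of \<open>G\<close>.\<close>

lemma le_time_complexity:
  assumes "parity_game G" "parity_game H" "subgame H G"
  shows "enat (T H) \<le> time_complexity T (card (nodes G)) (card (edges G)) (max_colour G)"
  unfolding time_complexity_def
  using assms(2) card_nodes_subgame[OF assms(1,3)] card_edges_subgame[OF assms(1,3)]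
    max_colour_subgame[OF assms(1,3)]
  by (intro SUP_upper) simp

lemma lift_time_le:
  assumes \<rho>: "partial_solver \<rho>" and S: "valid_schedule S" and G: "parity_game G"
    and M: "\<And>H. parity_game H \<Longrightarrow> subgame H G \<Longrightarrow> T H + b H \<le> M"
  shows "lift_time S \<rho> T b G \<le> (1 + 2 * excess G) * (1 + excess G) * M"
proof -
  obtain r where r: "lift_run S \<rho> G = Some r"
    "\<And>H. H \<in> set (main_calls r @ loop_calls r) \<Longrightarrow> parity_game H \<and> subgame H G"
    "length (main_calls r @ loop_calls r) \<le> (1 + 2 * excess G) * (1 + excess G)"
    using lift_run_calls[OF \<rho> S G] by blast
  have "lift_time S \<rho> T b G = (\<Sum>H \<leftarrow> main_calls r @ loop_calls r. T H + b H)"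
    by (simp add: lift_time_def r(1))
  also have "\<dots> \<le> (\<Sum>H \<leftarrow> main_calls r @ loop_calls r. M)"
    using r(2) M by (intro sum_list_mono) blast
  also have "\<dots> = length (main_calls r @ loop_calls r) * M" by (simp only: sum_list_triv of_nat_id)
  also have "\<dots> \<le> (1 + 2 * excess G) * (1 + excess G) * M"
    by (rule mult_le_mono1[OF r(3)])
  finally show ?thesis .
qed

lemma poly_nat_mono: "x \<le> y \<Longrightarrow> poly q x \<le> poly q y" for q :: "nat poly"
  by (induction q) (auto intro: add_mono mult_mono)

lemma lift_time_le_time_complexity:
  assumes \<rho>: "partial_solver \<rho>" and S: "valid_schedule S"
    and b: "at_most_linear b" and T: "at_least_linear T"
  shows "\<exists>C. \<forall>G. parity_game G \<longrightarrow>
    enat (lift_time S \<rho> T b G) \<le> enat (C * (max 1 (card (edges G) - card (nodes G)))\<^sup>2)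
      * time_complexity T (card (nodes G)) (card (edges G)) (max_colour G)"
proof -
  obtain K where K: "\<And>G. parity_game G \<Longrightarrow> b G \<le> K * graph_size G"
    using b by (auto simp: at_most_linear_def)
  obtain K' where K': "\<And>G. parity_game G \<Longrightarrow> graph_size G \<le> K' * T G"
    using T by (auto simp: at_least_linear_def)
  \<comment> \<open>The 6 comes from 1 + 2 x \<le> 3 max 1 x and 1 + x \<le> 2 max 1 x; the other
    factor absorbs the overhead \<open>b\<close> into \<open>T\<close>.\<close>
  define C where "C = 6 * (1 + K * K')"
  have "enat (lift_time S \<rho> T b G) \<le> enat (C * (max 1 (card (edges G) - card (nodes G)))\<^sup>2)
      * time_complexity T (card (nodes G)) (card (edges G)) (max_colour G)"
    if G: "parity_game G" for G
  proof (cases "time_complexity T (card (nodes G)) (card (edges G)) (max_colour G)")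
    case (enat t)
    have "T H + b H \<le> (1 + K * K') * t" if H: "parity_game H" "subgame H G" for H
    proof -
      have "T H \<le> t" using le_time_complexity[OF G H, of T] enat by simp
      have "b H \<le> K * (K' * T H)" using K[OF H(1)] K'[OF H(1)] by (meson le_trans mult_le_mono2)
      also have "\<dots> \<le> K * (K' * t)" using \<open>T H \<le> t\<close> by (intro mult_le_mono2)
      finally show ?thesis using \<open>T H \<le> t\<close> by (simp add: algebra_simps)
    qed
    then have "lift_time S \<rho> T b G \<le> (1 + 2 * excess G) * (1 + excess G) * ((1 + K * K') * t)"
      by (rule lift_time_le[OF \<rho> S G])
    also have "(1 + 2 * excess G) * (1 + excess G) \<le> (3 * max 1 (excess G)) * (2 * max 1 (excess G))"
      by (intro mult_le_mono) auto
    also have "(3 * max 1 (excess G)) * (2 * max 1 (excess G)) * ((1 + K * K') * t)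
        = C * (max 1 (excess G))\<^sup>2 * t"
      by (simp add: C_def power2_eq_square algebra_simps)
    finally have "lift_time S \<rho> T b G \<le> C * (max 1 (excess G))\<^sup>2 * t" by simp
    then show ?thesis using enat card_edges[OF G] by simp
  next
    case infinity
    \<comment> \<open>A nonzero factor keeps the product infinite, since 0 times infinity is 0 in
      \<open>enat\<close>.\<close>
    have "C * (max 1 (card (edges G) - card (nodes G)))\<^sup>2 \<noteq> 0" by (simp add: C_def)
    then show ?thesis using infinity by (simp add: imult_is_infinity zero_enat_def)
  qed
  then show ?thesis by blast
qed

lemma polynomial_time_lift_time:
  assumes \<rho>: "partial_solver \<rho>" and S: "valid_schedule S"
    and b: "at_most_linear b" and T: "polynomial_time T"
  shows "polynomial_time (lift_time S \<rho> T b)"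
proof -
  obtain K where K: "\<And>G. parity_game G \<Longrightarrow> b G \<le> K * graph_size G"
    using b by (auto simp: at_most_linear_def)
  obtain q where q: "\<And>G. parity_game G \<Longrightarrow> T G \<le> poly q (input_length G)"
    using T by (auto simp: polynomial_time_def)
  \<comment> \<open>The number of calls, with \<open>excess\<close> bounded by the input length,
    times the solver time plus the linear overhead.\<close>
  let ?q = "[:1, 2:] * [:1, 1:] * (q + smult K [:1, 1:])"
  have "lift_time S \<rho> T b G \<le> poly ?q (input_length G)" if G: "parity_game G" for G
  proof -
    define L where "L = input_length G"
    have "T H + b H \<le> poly q L + K * (1 + L)" if H: "parity_game H" "subgame H G" for H
    proof -
      have L: "input_length H \<le> L" unfolding L_def using G H(2) by (rule input_length_subgame)
      then have "graph_size H \<le> 1 + L" by (simp add: graph_size_def input_length_def)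
      then have "b H \<le> K * (1 + L)" using K[OF H(1)] by (meson le_trans mult_le_mono2)
      moreover have "T H \<le> poly q L" using q[OF H(1)] poly_nat_mono[OF L] le_trans by blast
      ultimately show ?thesis by simp
    qed
    then have "lift_time S \<rho> T b G
        \<le> (1 + 2 * excess G) * (1 + excess G) * (poly q L + K * (1 + L))"
      by (rule lift_time_le[OF \<rho> S G])
    also have "excess G \<le> L" using card_edges[OF G] by (simp add: L_def input_length_def)
    then have "(1 + 2 * excess G) * (1 + excess G) * (poly q L + K * (1 + L))
        \<le> (1 + 2 * L) * (1 + L) * (poly q L + K * (1 + L))"
      by (intro mult_le_mono add_le_mono order_refl)
    also have "\<dots> = poly ?q L" by (simp add: algebra_simps)
    finally show ?thesis by (simp only: L_def)
  qed
  then show ?thesis unfolding polynomial_time_def by blast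
qed

text \<open>Termination comes first because it gives \<open>the\<close> in \<open>lift\<close> and
  \<open>lift_time\<close> its meaning. The \<open>max 1\<close> accounts for games with as many
  edges as nodes, on which the solver is still applied once.\<close>

theorem theorem9:
  fixes \<rho> :: "'v solver" and S :: "'v schedule"
  assumes "partial_solver \<rho>" and "soundness \<rho>" and "valid_schedule S"
  shows "(\<forall>G. parity_game G \<longrightarrow> lift_run S \<rho> G \<noteq> None) \<and>
    (removes_attractors \<rho> \<and> soundness \<rho> \<and> idempotency \<rho> \<and> locality \<rho>
       \<longrightarrow> soundness (lift S \<rho>)) \<and>
    (\<forall>T b. at_most_linear b \<longrightarrow>
       (at_least_linear T \<longrightarrow>
          (\<exists>C. \<forall>G. parity_game G \<longrightarrow>
             enat (lift_time S \<rho> T b G)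
               \<le> enat (C * (max 1 (card (edges G) - card (nodes G)))\<^sup>2)
                   * time_complexity T (card (nodes G)) (card (edges G)) (max_colour G))) \<and>
       (polynomial_time T \<longrightarrow> polynomial_time (lift_time S \<rho> T b)))"
proof (intro conjI allI impI)
  fix G :: "'v game"
  assume "parity_game G"
  then show "lift_run S \<rho> G \<noteq> None" using lift_run_calls[OF assms(1,3)] by blast
next
  assume "removes_attractors \<rho> \<and> soundness \<rho> \<and> idempotency \<rho> \<and> locality \<rho>"
  then show "soundness (lift S \<rho>)" using assms by (blast intro: soundness_lift)
next
  fix T b :: "'v game \<Rightarrow> nat"
  assume b: "at_most_linear b"
  show "\<exists>C. \<forall>G. parity_game G \<longrightarrow>
      enat (lift_time S \<rho> T b G) \<le> enat (C * (max 1 (card (edges G) - card (nodes G)))\<^sup>2)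
        * time_complexity T (card (nodes G)) (card (edges G)) (max_colour G)"
    if "at_least_linear T"
    using assms(1,3) b that by (rule lift_time_le_time_complexity)
  show "polynomial_time (lift_time S \<rho> T b)" if "polynomial_time T"
    using assms(1,3) b that by (rule polynomial_time_lift_time)
qed

end
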